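(* Let $\mathcal{G}=(G_n)_{n\ge1}$ be an $\mathrm{Inc}$-invariant chain of graphs with stability index $\mathrm{ind}(\mathcal{G})=r$ and sparsity index $\mathrm{sp}(\mathcal{G})=s$. Assume that $V(G_r)=[r]$ and that $(1,i),(j,r)\in E(G_r)$ for some $i,j\in[r]$. Denote by $\nu(\mathrm{IN}(G_n))$ the number of facets of the independence complex $\mathrm{IN}(G_n)$. Then there exists a constant $C\in\mathbb{Z}$ such that $$\nu(\mathrm{IN}(G_n))=n+C\quad\text{for all }n\ge5r+2s.$$
   Context: $\mathbb{N}$ is the set of positive integers and $[n]=\{1,\dots,n\}$. Graphs are simple and finite, with vertex set contained in $\mathbb{N}$ (possibly empty); an edge $\{i,j\}$ with $i<j$ is written $(i,j)$. $G\subseteq H$ means $V(G)\subseteq V(H)$ and $E(G)\subseteq E(H)$. $\mathrm{Inc}$ is the monoid of strictly increasing maps $\pi:\mathbb{N}\to\mathbb{N}$, and $\mathrm{Inc}_{n,m}=\{\pi\in\mathrm{Inc}\mid\pi(n)\le m\}$ for $n\le m$. For $\Gamma\subseteq\mathrm{Inc}$ and a graph $G$, $\Gamma(G)$ is the graph with vertex set $\bigcup_{\pi\in\Gamma}\pi(V(G))$ and edge set $\{(\pi(i),\pi(j))\mid \pi\in\Gamma,(i,j)\in E(G)\}$. An $\mathrm{Inc}$-invariant chain of graphs is a sequence $(G_n)_{n\ge1}$ of graphs with $V(G_n)\subseteq[n]$ and $\mathrm{Inc}_{n,m}(G_n)\subseteq G_m$ for all $m\ge n\ge1$. Every such chain stabilizes: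 there is $r\in\mathbb{N}$ with $\mathrm{Inc}_{n,m}(G_n)=G_m$ for all $m\ge n\ge r$; the smallest such $r$ is the stability index $\mathrm{ind}(\mathcal{G})$. The sparsity index is $\mathrm{sp}(\mathcal{G})=\min\{j-i\mid(i,j)\in E(G_r)\}$, where $r=\mathrm{ind}(\mathcal{G})$. The independence complex $\mathrm{IN}(G)$ is the simplicial complex on $V(G)$ whose faces are the independent sets of $G$; its facets are the inclusion-maximal independent sets. *)

theory Defs
  imports Main
begin

text \<open>
  Graphs are simple, with finite vertex set inside the positive integers. An edge
  between \<open>i < j\<close> is stored as the ordered pair \<open>(i, j)\<close>, so that each
  undirected edge has exactly one representative.
\<close>

record graph =
  verts :: "nat set"
  edges :: "(nat \<times> nat) set"

definition is_graph :: "graph \<Rightarrow> bool" where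
  "is_graph G \<longleftrightarrow>
     finite (verts G) \<and> verts G \<subseteq> {1..} \<and>
     (\<forall>(i, j) \<in> edges G. i \<in> verts G \<and> j \<in> verts G \<and> i < j)"

definition subgraph :: "graph \<Rightarrow> graph \<Rightarrow> bool" where
  "subgraph G H \<longleftrightarrow> verts G \<subseteq> verts H \<and> edges G \<subseteq> edges H"

text \<open>
  The strictly increasing self-maps of the positive integers are functions on \<^typ>\<open>nat\<close>
  whose value at \<open>0\<close> is unconstrained; that value never matters below.
\<close>

definition Inc :: "(nat \<Rightarrow> nat) set" where
  "Inc = {\<pi>. strict_mono_on {1..} \<pi> \<and> \<pi> ` {1..} \<subseteq> {1..}}"

definition Inc_upto :: "nat \<Rightarrow> nat \<Rightarrow> (nat \<Rightarrow> nat) set" where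
  "Inc_upto n m = {\<pi> \<in> Inc. \<pi> n \<le> m}"

definition graph_image :: "(nat \<Rightarrow> nat) set \<Rightarrow> graph \<Rightarrow> graph" where
  "graph_image \<Gamma> G =
     \<lparr>verts = (\<Union>\<pi>\<in>\<Gamma>. \<pi> ` verts G),
      edges = {(\<pi> i, \<pi> j) | \<pi> i j. \<pi> \<in> \<Gamma> \<and> (i, j) \<in> edges G}\<rparr>"

text \<open>A chain is indexed by the positive integers; the entry at index \<open>0\<close> is ignored.\<close>

definition inc_invariant_chain :: "(nat \<Rightarrow> graph) \<Rightarrow> bool" where
  "inc_invariant_chain G \<longleftrightarrow>
     (\<forall>n\<ge>1. is_graph (G n) \<and> verts (G n) \<subseteq> {1..n}) \<and>
     (\<forall>n\<ge>1. \<forall>m\<ge>n. subgraph (graph_image (Inc_upto n m) (G n)) (G m))"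

text \<open>Every invariant chain stabilizes, so for these the least index exists.\<close>

definition stability_index :: "(nat \<Rightarrow> graph) \<Rightarrow> nat" where
  "stability_index G =
     (LEAST r. r \<ge> 1 \<and> (\<forall>n\<ge>r. \<forall>m\<ge>n. graph_image (Inc_upto n m) (G n) = G m))"

text \<open>Meaningful only when the graph at the stability index has an edge.\<close>

definition sparsity_index :: "(nat \<Rightarrow> graph) \<Rightarrow> nat" where
  "sparsity_index G = Min {j - i | i j. (i, j) \<in> edges (G (stability_index G))}"

definition independent_set :: "graph \<Rightarrow> nat set \<Rightarrow> bool" where
  "independent_set G S \<longleftrightarrow> S \<subseteq> verts G \<and> (\<forall>(i, j) \<in> edges G. \<not> (i \<in> S \<and> j \<in> S))"

text \<open>A simplicial complex is given by its set of faces, the empty face included.\<close>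

definition independence_complex :: "graph \<Rightarrow> nat set set" where
  "independence_complex G = {S. independent_set G S}"

definition facets :: "nat set set \<Rightarrow> nat set set" where
  "facets \<Delta> = {F \<in> \<Delta>. \<forall>F' \<in> \<Delta>. F \<subseteq> F' \<longrightarrow> F' = F}"

end

theory Submission
  imports Defs
begin

text \<open>
  Why the theorem is true. An edge \<open>(i, j)\<close> of \<open>G\<^sub>r\<close> is moved by the increasing maps to exactly
  those pairs \<open>x < y\<close> in \<open>{1..n}\<close> for which each of the three gaps (left of \<open>x\<close>, between \<open>x\<close> and
  \<open>y\<close>, right of \<open>y\<close>) is at least the corresponding gap of \<open>(i, j)\<close> in \<open>{1..r}\<close>. So for \<open>n \<ge> r\<close> the
  graph \<open>G\<^sub>n\<close> is given by finitely many linear inequalities.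

  Call the vertices in \<open>{2r..n-2r}\<close> central. The edges \<open>(1, i)\<close> and \<open>(j, r)\<close> join a central vertex
  to everything far away from it, and a shortest edge joins it to everything at distance at least
  \<open>s\<close> that is not too far; hence a central vertex is adjacent exactly to the vertices at distance
  at least \<open>s\<close> (\<open>adj_central_iff\<close>). Two consequences give the count. A facet that contains a central
  vertex is an interval of \<open>s\<close> consecutive vertices, and there are \<open>n - 4r + s\<close> of these
  (\<open>card_facets_central\<close>). A facet without central vertices sees the central part only through
  the two extreme central vertices \<open>2r\<close> and \<open>n - 2r\<close>: if both of them are blocked, then so is
  everything between them (\<open>max_indep_off_central_iff\<close>; the bound \<open>n \<ge> 5r + 2s\<close> enters here).
  Such facets are therefore determined by the graph induced on
  \<open>{1..2r} \<union> {n-2r..n}\<close>, whose isomorphism type is the same for all large \<open>n\<close>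
  (\<open>edge_of_stretch_iff\<close>), so their number is constant.

  The minimum that defines the stability index must be known to exist. The position of an edge
  is a triple of gaps, the triples that occur form an upward closed set, and Dickson's lemma
  shows that such a set is generated in bounded degree (\<open>upclosed_degree_bound\<close>).
\<close>

section \<open>Dickson's lemma for triples\<close>

text \<open>
  The witness sends \<open>k\<close> to the first place where the tail of \<open>f\<close> from \<open>k\<close> on is minimal. It is
  monotone but not injective; monotonicity and \<open>k \<le> t k\<close> are what survives iteration.
\<close>

lemma nondecreasing_reindexing:
  fixes f :: "nat \<Rightarrow> nat"
  obtains t where "\<And>k. k \<le> t k" "mono t" "mono (\<lambda>k. f (t k))"
proof -
  define P where "P k i \<longleftrightarrow> k \<le> i \<and> (\<forall>l\<ge>k. f i \<le> f l)" for k i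
  define t where "t k = (LEAST i. P k i)" for k
  have "\<exists>i. P k i" for k
  proof -
    have "\<exists>i. k \<le> i \<and> (\<forall>l. k \<le> l \<longrightarrow> f i \<le> f l)"
      using ex_has_least_nat[of "\<lambda>i. k \<le> i" k f] by simp
    then show ?thesis by (simp add: P_def)
  qed
  then have t: "P k (t k)" for k
    unfolding t_def by (meson LeastI_ex)
  have "t k \<le> t (Suc k)" for k
  proof (cases "t k = k")
    case True
    then show ?thesis using t[of "Suc k"] by (simp add: P_def)
  next
    case False
    then have "P k (t (Suc k))"
      using t[of k] t[of "Suc k"] unfolding P_def
      by (metis Suc_leD le_antisym not_less_eq_eq le_trans)
    then show ?thesis unfolding t_def by (rule Least_le)
  qed
  then have "mono t" by (simp add: mono_iff_le_Suc)
  moreover have "mono (\<lambda>k. f (t k))"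
    using t unfolding mono_iff_le_Suc P_def by (meson Suc_leD)
  ultimately show ?thesis using t that unfolding P_def by blast
qed

text \<open>
  Generation in bounded degree. A counterexample for every bound would be a sequence of triples;
  along a reindexing that is nondecreasing in all three entries, a late member lies above
  an early one, which has small degree and can be enlarged to the required degree.
\<close>

lemma upclosed_degree_bound:
  fixes P :: "nat \<Rightarrow> nat \<Rightarrow> nat \<Rightarrow> bool"
  assumes up: "\<And>a b c a' b' c'. P a b c \<Longrightarrow> a \<le> a' \<Longrightarrow> b \<le> b' \<Longrightarrow> c \<le> c' \<Longrightarrow> P a' b' c'"
  shows "\<exists>r. \<forall>n\<ge>r. \<forall>a b c. n \<le> a + b + c \<longrightarrow> P a b c \<longrightarrow>
    (\<exists>a' b' c'. a' \<le> a \<and> b' \<le> b \<and> c' \<le> c \<and> a' + b' + c' = n \<and> P a' b' c')"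
proof (rule ccontr)
  assume contra: "\<not> ?thesis"
  define bad where "bad r n a b c \<longleftrightarrow> r \<le> n \<and> n \<le> a + b + c \<and> P a b c \<and>
    (\<forall>a' b' c'. a' \<le> a \<and> b' \<le> b \<and> c' \<le> c \<and> a' + b' + c' = n \<longrightarrow> \<not> P a' b' c')" for r n a b c
  have "\<exists>n a b c. bad r n a b c" for r
    using contra unfolding bad_def by (metis (no_types, lifting))
  then obtain n f g h where bad: "\<And>r. bad r (n r) (f r) (g r) (h r)" by metis
  obtain t where t: "\<And>k. k \<le> t k" "mono t" "mono (\<lambda>k. f (t k))"
    using nondecreasing_reindexing[of f] by blast
  obtain u where u: "\<And>k. k \<le> u k" "mono u" "mono (\<lambda>k. g (t (u k)))"
    using nondecreasing_reindexing[of "\<lambda>k. g (t k)"] by blast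
  obtain v where v: "\<And>k. k \<le> v k" "mono v" "mono (\<lambda>k. h (t (u (v k))))"
    using nondecreasing_reindexing[of "\<lambda>k. h (t (u k))"] by blast
  define w where "w k = t (u (v k))" for k
  define k where "k = f (w 0) + g (w 0) + h (w 0)"
  have "f (w 0) \<le> f (w k)" "g (w 0) \<le> g (w k)" "h (w 0) \<le> h (w k)"
    using t u v unfolding w_def by (auto simp: mono_def)
  moreover have "k \<le> n (w k)"
    using t(1) u(1) v(1) bad unfolding w_def bad_def by (meson le_trans)
  moreover have "n (w k) \<le> f (w k) + g (w k) + h (w k)" using bad by (simp add: bad_def)
  \<comment> \<open>The early triple is raised to the required degree one entry after the other, each as far as
    the late triple and the degree allow.\<close>
  moreover define x where "x = min (f (w k)) (n (w k) - g (w 0) - h (w 0))"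
  moreover define y where "y = min (g (w k)) (n (w k) - x - h (w 0))"
  moreover define z where "z = n (w k) - x - y"
  ultimately have between: "f (w 0) \<le> x" "g (w 0) \<le> y" "h (w 0) \<le> z"
      "x \<le> f (w k)" "y \<le> g (w k)" "z \<le> h (w k)" "x + y + z = n (w k)"
    unfolding k_def by linarith+
  have "P (f (w 0)) (g (w 0)) (h (w 0))" using bad by (simp add: bad_def)
  then have "P x y z" using up between(1-3) by blast
  then show False using bad[of "w k"] between(4-7) by (simp add: bad_def)
qed

section \<open>Stabilization and the edges beyond the stability index\<close>

lemma Inc_diff_le:
  assumes "\<pi> \<in> Inc" "1 \<le> i" "i \<le> j"
  shows "\<pi> i + j \<le> \<pi> j + i"
  using assms(3)
proof (induction rule: dec_induct)
  case (step k)
  moreover have "\<pi> k < \<pi> (Suc k)"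
    using assms(1,2) step(1) by (auto simp: Inc_def strict_mono_on_def)
  ultimately show ?case by simp
qed simp

lemma Inc_le:
  assumes "\<pi> \<in> Inc" "1 \<le> i"
  shows "i \<le> \<pi> i"
proof -
  have "1 \<le> \<pi> 1" using assms(1) by (auto simp: Inc_def)
  then show ?thesis using Inc_diff_le[OF assms(1) _ assms(2)] by simp
qed

text \<open>
  An increasing map can stretch the three gaps of a pair by any amounts, and \<open>Inc_diff_le\<close>
  and \<open>Inc_le\<close> say that it can never shrink them.
\<close>

lemma Inc_upto_stretch:
  assumes "1 \<le> i" "i < j" "j \<le> n" "i \<le> x" "x + j \<le> y + i" "y + n \<le> m + j"
  obtains \<pi> where "\<pi> \<in> Inc_upto n m" "\<pi> i = x" "\<pi> j = y"
proof -
  define \<pi> where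
    "\<pi> k = (if k < i then k else if k < j then k + (x - i) else k + (y - j))" for k
  have "\<pi> \<in> Inc_upto n m"
    using assms by (auto simp: \<pi>_def Inc_upto_def Inc_def strict_mono_on_def)
  moreover have "\<pi> i = x" "\<pi> j = y" using assms by (auto simp: \<pi>_def)
  ultimately show ?thesis using that by blast
qed

lemma Inc_upto_move:
  assumes "1 \<le> i" "i \<le> n" "i \<le> x" "x + n \<le> m + i"
  obtains \<pi> where "\<pi> \<in> Inc_upto n m" "\<pi> i = x"
proof -
  define \<pi> where "\<pi> k = (if k < i then k else k + (x - i))" for k
  have "\<pi> \<in> Inc_upto n m"
    using assms by (auto simp: \<pi>_def Inc_upto_def Inc_def strict_mono_on_def)
  moreover have "\<pi> i = x" using assms by (auto simp: \<pi>_def)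
  ultimately show ?thesis using that by blast
qed

lemma chain_edgeD:
  assumes "inc_invariant_chain G" "1 \<le> n" "(i, j) \<in> edges (G n)"
  shows "1 \<le> i" "i < j" "j \<le> n"
  using assms unfolding inc_invariant_chain_def is_graph_def by fastforce+

lemma chain_vertD:
  assumes "inc_invariant_chain G" "1 \<le> n" "i \<in> verts (G n)"
  shows "1 \<le> i" "i \<le> n"
  using assms unfolding inc_invariant_chain_def by fastforce+

lemma chain_edge_stretch:
  assumes "inc_invariant_chain G" "1 \<le> n" "n \<le> m" "(i, j) \<in> edges (G n)"
    and "i \<le> x" "x + j \<le> y + i" "y + n \<le> m + j"
  shows "(x, y) \<in> edges (graph_image (Inc_upto n m) (G n))" "(x, y) \<in> edges (G m)"
proof -
  obtain \<pi> where "\<pi> \<in> Inc_upto n m" "\<pi> i = x" "\<pi> j = y"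
    using Inc_upto_stretch chain_edgeD[OF assms(1,2,4)] assms(5-7) by blast
  then show image: "(x, y) \<in> edges (graph_image (Inc_upto n m) (G n))"
    using assms(4) by (force simp: graph_image_def)
  have "subgraph (graph_image (Inc_upto n m) (G n)) (G m)"
    using assms(1-3) by (simp add: inc_invariant_chain_def)
  then show "(x, y) \<in> edges (G m)" using image by (auto simp: subgraph_def)
qed

lemma chain_vert_move:
  assumes "inc_invariant_chain G" "1 \<le> n" "n \<le> m" "i \<in> verts (G n)"
    and "i \<le> x" "x + n \<le> m + i"
  shows "x \<in> verts (graph_image (Inc_upto n m) (G n))" "x \<in> verts (G m)"
proof -
  obtain \<pi> where "\<pi> \<in> Inc_upto n m" "\<pi> i = x"
    using Inc_upto_move chain_vertD[OF assms(1,2,4)] assms(5,6) by blast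
  then show image: "x \<in> verts (graph_image (Inc_upto n m) (G n))"
    using assms(4) by (force simp: graph_image_def)
  have "subgraph (graph_image (Inc_upto n m) (G n)) (G m)"
    using assms(1-3) by (simp add: inc_invariant_chain_def)
  then show "x \<in> verts (G m)" using image by (auto simp: subgraph_def)
qed

text \<open>
  Dickson's lemma is applied to the gap triples of edges, and to vertices as triples whose last
  two entries only matter through their sum.
\<close>

lemma chain_stabilizes:
  assumes chain: "inc_invariant_chain G"
  shows "\<exists>r\<ge>1. \<forall>n\<ge>r. \<forall>m\<ge>n. graph_image (Inc_upto n m) (G n) = G m"
proof -
  define E where "E a b c \<longleftrightarrow> 1 \<le> a \<and> (a, a + b) \<in> edges (G (a + b + c))" for a b c
  define V where "V a b c \<longleftrightarrow> 1 \<le> a \<and> a \<in> verts (G (a + b + c))" for a b c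
  have E_up: "E a' b' c'" if "E a b c" "a \<le> a'" "b \<le> b'" "c \<le> c'" for a b c a' b' c'
    using that chain_edge_stretch(2)[OF chain, of "a + b + c" "a' + b' + c'" a "a + b" a' "a' + b'"]
    by (auto simp: E_def)
  obtain p where p: "\<forall>n\<ge>p. \<forall>a b c. n \<le> a + b + c \<longrightarrow> E a b c \<longrightarrow>
    (\<exists>a' b' c'. a' \<le> a \<and> b' \<le> b \<and> c' \<le> c \<and> a' + b' + c' = n \<and> E a' b' c')"
    by (rule exE[OF upclosed_degree_bound[of E]]) (use E_up in blast)+
  have V_up: "V a' b' c'" if "V a b c" "a \<le> a'" "b \<le> b'" "c \<le> c'" for a b c a' b' c'
    using that chain_vert_move(2)[OF chain, of "a + b + c" "a' + b' + c'" a a']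
    by (auto simp: V_def)
  obtain q where q: "\<forall>n\<ge>q. \<forall>a b c. n \<le> a + b + c \<longrightarrow> V a b c \<longrightarrow>
    (\<exists>a' b' c'. a' \<le> a \<and> b' \<le> b \<and> c' \<le> c \<and> a' + b' + c' = n \<and> V a' b' c')"
    by (rule exE[OF upclosed_degree_bound[of V]]) (use V_up in blast)+
  have "graph_image (Inc_upto n m) (G n) = G m" if "Suc (p + q) \<le> n" "n \<le> m" for n m
  proof -
    have n: "1 \<le> n" "1 \<le> m" "p \<le> n" "q \<le> n" using that by auto
    have sub: "subgraph (graph_image (Inc_upto n m) (G n)) (G m)"
      using chain n that by (simp add: inc_invariant_chain_def)
    have "(x, y) \<in> edges (graph_image (Inc_upto n m) (G n))" if e: "(x, y) \<in> edges (G m)" for x y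
    proof -
      have xy: "1 \<le> x" "x < y" "y \<le> m" using chain_edgeD[OF chain n(2) e] .
      then have gaps: "E x (y - x) (m - y)" "n \<le> x + (y - x) + (m - y)"
        using e \<open>n \<le> m\<close> by (auto simp: E_def)
      then obtain a b c where "a \<le> x" "b \<le> y - x" "c \<le> m - y" "a + b + c = n" "E a b c"
        using p[rule_format, OF n(3) gaps(2,1)] by blast
      then show ?thesis
        using chain_edge_stretch(1)[OF chain n(1) \<open>n \<le> m\<close>, of a "a + b" x y] xy
        by (auto simp: E_def)
    qed
    moreover have "x \<in> verts (graph_image (Inc_upto n m) (G n))" if v: "x \<in> verts (G m)" for x
    proof -
      have x: "1 \<le> x" "x \<le> m" using chain_vertD[OF chain n(2) v] .
      then have gaps: "V x 0 (m - x)" "n \<le> x + 0 + (m - x)"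
        using v \<open>n \<le> m\<close> by (auto simp: V_def)
      then obtain a b c where "a \<le> x" "b \<le> 0" "c \<le> m - x" "a + b + c = n" "V a b c"
        using q[rule_format, OF n(4) gaps(2,1)] by blast
      then show ?thesis
        using chain_vert_move(1)[OF chain n(1) \<open>n \<le> m\<close>, of a x] x
        by (auto simp: V_def)
    qed
    ultimately show ?thesis
      using sub by (intro graph.equality) (auto simp: subgraph_def)
  qed
  then show ?thesis by (intro exI[of _ "Suc (p + q)"]) auto
qed

lemma stability_index_stable:
  assumes "inc_invariant_chain G"
  shows "1 \<le> stability_index G"
    and "stability_index G \<le> n \<Longrightarrow> n \<le> m \<Longrightarrow> graph_image (Inc_upto n m) (G n) = G m"
  using LeastI_ex[OF chain_stabilizes[OF assms], folded stability_index_def] by blast+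

text \<open>
  The pairs into which the increasing maps from \<open>{1..r}\<close> to \<open>{1..n}\<close> move the members of \<open>E\<close>:
  none of the three gaps may shrink. The inequalities are kept free of subtraction.
\<close>

definition edge_of :: "(nat \<times> nat) set \<Rightarrow> nat \<Rightarrow> nat \<Rightarrow> nat \<Rightarrow> nat \<Rightarrow> bool" where
  "edge_of E r n x y \<longleftrightarrow> (\<exists>(i, j) \<in> E. i \<le> x \<and> x + j \<le> y + i \<and> y + r \<le> n + j)"

lemma edges_beyond_stability:
  assumes chain: "inc_invariant_chain G" and "stability_index G = r" "r \<le> n"
  shows "(x, y) \<in> edges (G n) \<longleftrightarrow> edge_of (edges (G r)) r n x y"
proof
  have r: "1 \<le> r" and stable: "graph_image (Inc_upto r n) (G r) = G n"
    using stability_index_stable[OF chain] assms(2,3) by blast+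
  {
    assume "(x, y) \<in> edges (G n)"
    then obtain \<pi> i j where \<pi>: "\<pi> \<in> Inc_upto r n" "(i, j) \<in> edges (G r)" "x = \<pi> i" "y = \<pi> j"
      by (auto simp: graph_image_def simp flip: stable)
    have ij: "1 \<le> i" "i < j" "j \<le> r" using chain_edgeD[OF chain r \<pi>(2)] .
    have inc: "\<pi> \<in> Inc" "\<pi> r \<le> n" using \<pi>(1) by (auto simp: Inc_upto_def)
    show "edge_of (edges (G r)) r n x y"
      using \<pi>(2-4) ij inc(2) Inc_le[OF inc(1), of i]
        Inc_diff_le[OF inc(1), of i j] Inc_diff_le[OF inc(1), of j r]
      unfolding edge_of_def by (intro bexI[of _ "(i, j)"]) auto
  }
  assume "edge_of (edges (G r)) r n x y"
  then show "(x, y) \<in> edges (G n)"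
    using chain_edge_stretch(2)[OF chain r \<open>r \<le> n\<close>] unfolding edge_of_def by blast
qed

lemma verts_beyond_stability:
  assumes chain: "inc_invariant_chain G" and "stability_index G = r" "r \<le> n"
    and "verts (G r) = {1..r}"
  shows "verts (G n) = {1..n}"
proof -
  have r: "1 \<le> r" using stability_index_stable(1)[OF chain] assms(2) by simp
  \<comment> \<open>A vertex beyond \<open>r\<close> is an image of \<open>r\<close>, any other one is an image of itself.\<close>
  have "x \<in> verts (G n)" if "1 \<le> x" "x \<le> n" for x
    using chain_vert_move(2)[OF chain r \<open>r \<le> n\<close>, of "min x r" x] that assms(3,4) r by auto
  moreover have "verts (G n) \<subseteq> {1..n}"
    using chain r \<open>r \<le> n\<close> by (auto simp: inc_invariant_chain_def)
  ultimately show ?thesis by auto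
qed

section \<open>Maximal independent sets\<close>

definition max_indep :: "('a \<Rightarrow> 'a \<Rightarrow> bool) \<Rightarrow> 'a set \<Rightarrow> 'a set \<Rightarrow> bool" where
  "max_indep A V F \<longleftrightarrow> F \<subseteq> V \<and> (\<forall>x\<in>F. \<forall>y\<in>F. \<not> A x y) \<and> (\<forall>v\<in>V - F. \<exists>u\<in>F. A u v)"

lemma facets_independence_complex:
  assumes edges: "\<And>x y. (x, y) \<in> edges G \<Longrightarrow> x < y"
  shows "F \<in> facets (independence_complex G) \<longleftrightarrow>
    max_indep (\<lambda>x y. (x, y) \<in> edges G \<or> (y, x) \<in> edges G) (verts G) F"
proof -
  have extends: "\<not> independent_set G (insert v F) \<longleftrightarrow> (\<exists>u\<in>F. (u, v) \<in> edges G \<or> (v, u) \<in> edges G)"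
    if "independent_set G F" "v \<in> verts G" for v
    using that edges[of v v] by (auto simp: independent_set_def)
  have smaller: "independent_set G S" if "independent_set G S'" "S \<subseteq> S'" for S S'
    using that unfolding independent_set_def by blast
  have "(\<forall>F'. independent_set G F' \<longrightarrow> F \<subseteq> F' \<longrightarrow> F' = F) \<longleftrightarrow>
      (\<forall>v\<in>verts G - F. \<not> independent_set G (insert v F))" (is "?max \<longleftrightarrow> ?stuck")
  proof
    assume ?max
    then show ?stuck by (metis DiffD2 insertI1 subset_insertI)
  next
    assume stuck: ?stuck
    show ?max
    proof (intro allI impI)
      fix F' assume F': "independent_set G F'" "F \<subseteq> F'"
      have "v \<in> F" if "v \<in> F'" for v
      proof -
        have "v \<in> verts G" using F' that unfolding independent_set_def by blast
        moreover have "independent_set G (insert v F)" using smaller[OF F'(1)] F'(2) that by blast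
        ultimately show ?thesis using stuck by blast
      qed
      then show "F' = F" using F'(2) by blast
    qed
  qed
  then have "F \<in> facets (independence_complex G) \<longleftrightarrow>
      independent_set G F \<and> (\<forall>v\<in>verts G - F. \<not> independent_set G (insert v F))"
    by (simp add: facets_def independence_complex_def)
  also have "\<dots> \<longleftrightarrow> independent_set G F \<and>
      (\<forall>v\<in>verts G - F. \<exists>u\<in>F. (u, v) \<in> edges G \<or> (v, u) \<in> edges G)"
    using extends by blast
  also have "\<dots> \<longleftrightarrow> max_indep (\<lambda>x y. (x, y) \<in> edges G \<or> (y, x) \<in> edges G) (verts G) F"
    unfolding max_indep_def independent_set_def by blast
  finally show ?thesis .
qed

lemma max_indep_image:
  assumes "bij_betw \<phi> V V'" and adj: "\<And>x y. x \<in> V \<Longrightarrow> y \<in> V \<Longrightarrow> A' (\<phi> x) (\<phi> y) \<longleftrightarrow> A x y"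
    and "F \<subseteq> V"
  shows "max_indep A' V' (\<phi> ` F) \<longleftrightarrow> max_indep A V F"
proof -
  have inj: "inj_on \<phi> V" and V': "V' = \<phi> ` V" using assms(1) by (auto simp: bij_betw_def)
  have "V' - \<phi> ` F = \<phi> ` (V - F)"
    using inj \<open>F \<subseteq> V\<close> by (simp add: V' inj_on_image_set_diff[OF inj])
  then have "(\<forall>v\<in>V' - \<phi> ` F. \<exists>u\<in>\<phi> ` F. A' u v) \<longleftrightarrow> (\<forall>v\<in>V - F. \<exists>u\<in>F. A u v)"
    using adj \<open>F \<subseteq> V\<close> by (simp add: subset_iff)
  moreover have "(\<forall>x\<in>\<phi> ` F. \<forall>y\<in>\<phi> ` F. \<not> A' x y) \<longleftrightarrow> (\<forall>x\<in>F. \<forall>y\<in>F. \<not> A x y)"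
    using adj \<open>F \<subseteq> V\<close> by (simp add: subset_iff)
  moreover have "\<phi> ` F \<subseteq> V'" using V' \<open>F \<subseteq> V\<close> by blast
  ultimately show ?thesis using \<open>F \<subseteq> V\<close> by (simp add: max_indep_def)
qed

lemma card_max_indep_iso:
  assumes bij: "bij_betw \<phi> V V'"
    and adj: "\<And>x y. x \<in> V \<Longrightarrow> y \<in> V \<Longrightarrow> A' (\<phi> x) (\<phi> y) \<longleftrightarrow> A x y"
    and "K \<subseteq> V"
  shows "card {F. max_indep A V F \<and> F \<inter> K = {}} = card {F. max_indep A' V' F \<and> F \<inter> \<phi> ` K = {}}"
proof -
  have inj: "inj_on \<phi> V" and V': "V' = \<phi> ` V" using bij by (auto simp: bij_betw_def)
  have disj: "\<phi> ` F \<inter> \<phi> ` K = {} \<longleftrightarrow> F \<inter> K = {}" if "F \<subseteq> V" for F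
    using inj_on_image_Int[OF inj that \<open>K \<subseteq> V\<close>] by (metis image_is_empty)
  have image: "max_indep A' V' (\<phi> ` F) \<longleftrightarrow> max_indep A V F" if "F \<subseteq> V" for F
    using max_indep_image[of \<phi> V V' A' A F] bij adj that by blast
  have eq: "(`) \<phi> ` {F. max_indep A V F \<and> F \<inter> K = {}} = {F. max_indep A' V' F \<and> F \<inter> \<phi> ` K = {}}"
  proof (intro set_eqI iffI)
    fix F assume "F \<in> (`) \<phi> ` {F. max_indep A V F \<and> F \<inter> K = {}}"
    then obtain F0 where F0: "F = \<phi> ` F0" "max_indep A V F0" "F0 \<inter> K = {}" by blast
    then have "F0 \<subseteq> V" by (simp add: max_indep_def)
    then show "F \<in> {F. max_indep A' V' F \<and> F \<inter> \<phi> ` K = {}}"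
      using F0 disj image by auto
  next
    fix F assume F: "F \<in> {F. max_indep A' V' F \<and> F \<inter> \<phi> ` K = {}}"
    then have "F \<subseteq> \<phi> ` V" by (simp add: max_indep_def V')
    then obtain F0 where F0: "F0 \<subseteq> V" "F = \<phi> ` F0" by (auto simp: subset_image_iff)
    then have "max_indep A V F0" "F0 \<inter> K = {}"
      using F disj image by auto
    then show "F \<in> (`) \<phi> ` {F. max_indep A V F \<and> F \<inter> K = {}}" using F0 by blast
  qed
  have inj': "inj_on ((`) \<phi>) {F. max_indep A V F \<and> F \<inter> K = {}}"
    by (rule inj_on_subset[OF inj_on_image_Pow[OF inj]]) (auto simp: max_indep_def)
  show ?thesis using card_image[OF inj'] unfolding eq by simp
qed

section \<open>Central vertices\<close>

text \<open>
  For large \<open>n\<close> the number of facets depends on the chain only through the edges of \<open>G\<^sub>r\<close>, so the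
  count is carried out for a bare set \<open>E\<close> of generating edges.
\<close>

locale generating_edges =
  fixes E :: "(nat \<times> nat) set" and r s :: nat
  assumes edge_bounds: "(i, j) \<in> E \<Longrightarrow> 1 \<le> i \<and> i < j \<and> j \<le> r"
    and edge_from_first: "\<exists>i. (1, i) \<in> E"
    and edge_to_last: "\<exists>j. (j, r) \<in> E"
    and shortest_edge: "\<exists>i. (i, i + s) \<in> E"
    and sparse: "(i, j) \<in> E \<Longrightarrow> i + s \<le> j"
begin

abbreviation edge :: "nat \<Rightarrow> nat \<Rightarrow> nat \<Rightarrow> bool" where
  "edge \<equiv> edge_of E r"

definition adj :: "nat \<Rightarrow> nat \<Rightarrow> nat \<Rightarrow> bool" where
  "adj n x y \<longleftrightarrow> edge n x y \<or> edge n y x"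

lemma sparsity_bounds: "1 \<le> s" "s < r"
proof -
  obtain i where "(i, i + s) \<in> E" using shortest_edge by blast
  then show "1 \<le> s" "s < r" using edge_bounds[of i "i + s"] by auto
qed

lemma edge_imp_far: "edge n x y \<Longrightarrow> x + s \<le> y"
  using sparse by (fastforce simp: edge_of_def)

text \<open>
  The generators \<open>(i, i + s)\<close>, \<open>(1, i)\<close> and \<open>(j, r)\<close> have a short middle gap, no left gap and no
  right gap respectively, which is where the three sufficient conditions come from.
\<close>

lemma edge_bulk:
  assumes "r \<le> x" "x + s \<le> y" "y + r \<le> n"
  shows "edge n x y"
proof -
  obtain i where "(i, i + s) \<in> E" using shortest_edge by blast
  then show ?thesis
    using edge_bounds[of i "i + s"] assms
    unfolding edge_of_def by (intro bexI[of _ "(i, i + s)"]) auto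
qed

lemma edge_from_left:
  assumes "1 \<le> x" "x + r \<le> y" "y + r \<le> n"
  shows "edge n x y"
proof -
  obtain i where "(1, i) \<in> E" using edge_from_first by blast
  then show ?thesis
    using edge_bounds[of 1 i] assms
    unfolding edge_of_def by (intro bexI[of _ "(1, i)"]) auto
qed

lemma edge_to_right:
  assumes "r \<le> x" "x + r \<le> y" "y \<le> n"
  shows "edge n x y"
proof -
  obtain j where "(j, r) \<in> E" using edge_to_last by blast
  then show ?thesis
    using edge_bounds[of j r] assms
    unfolding edge_of_def by (intro bexI[of _ "(j, r)"]) auto
qed

text \<open>
  A vertex within \<open>r\<close> of a central one is still at distance \<open>r\<close> from both ends of \<open>{1..n}\<close>, so
  the shortest edge decides; any other vertex is at distance at least \<open>r\<close>, so the edges at the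
  two ends apply.
\<close>

lemma adj_central_iff:
  assumes "2 * r \<le> z" "z + 2 * r \<le> n" "1 \<le> w" "w \<le> n"
  shows "adj n w z \<longleftrightarrow> w + s \<le> z \<or> z + s \<le> w"
proof
  assume "adj n w z"
  then show "w + s \<le> z \<or> z + s \<le> w" using edge_imp_far by (auto simp: adj_def)
next
  assume "w + s \<le> z \<or> z + s \<le> w"
  then consider "w + s \<le> z" "r \<le> w" | "w + s \<le> z" "w < r"
    | "z + s \<le> w" "w + r \<le> n" | "z + s \<le> w" "n < w + r" by linarith
  then show "adj n w z"
  proof cases
    case 1
    then show ?thesis using edge_bulk[of w z n] assms by (simp add: adj_def)
  next
    case 2
    then show ?thesis using edge_from_left[of w z n] assms by (simp add: adj_def)
  next
    case 3
    then show ?thesis using edge_bulk[of z w n] assms by (simp add: adj_def)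
  next
    case 4
    then show ?thesis using edge_to_right[of z w n] assms by (simp add: adj_def)
  qed
qed

text \<open>
  All members of the set are within \<open>s\<close> of \<open>z\<close>, hence in the region where adjacency means distance
  at least \<open>s\<close>; independence then bounds the diameter, and maximality fills the interval that
  starts at the least member, because vertices at distance less than \<open>s\<close> are never adjacent.
\<close>

lemma max_indep_central_imp_interval:
  assumes F: "max_indep (adj n) {1..n} F"
    and z: "z \<in> F" "2 * r \<le> z" "z + 2 * r \<le> n"
  obtains m where "2 * r + 1 \<le> m + s" "m + 2 * r \<le> n" "F = {m..<m + s}"
proof -
  note s = sparsity_bounds
  have sub: "F \<subseteq> {1..n}" and ind: "\<And>x y. x \<in> F \<Longrightarrow> y \<in> F \<Longrightarrow> \<not> adj n x y"
    and max: "\<And>v. v \<in> {1..n} \<Longrightarrow> v \<notin> F \<Longrightarrow> \<exists>u\<in>F. adj n u v"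
    using F by (auto simp: max_indep_def)
  have near: "w < z + s" "z < w + s" if "w \<in> F" for w
  proof -
    have "\<not> (w + s \<le> z \<or> z + s \<le> w)"
      using ind[OF that z(1)] adj_central_iff[OF z(2,3), of w] sub that by auto
    then show "w < z + s" "z < w + s" by auto
  qed
  define m where "m = Min F"
  have fin: "finite F" using sub finite_subset by blast
  then have m: "m \<in> F" "\<And>x. x \<in> F \<Longrightarrow> m \<le> x"
    using z(1) unfolding m_def by (auto intro: Min_in)
  have close: "x < m + s" if "x \<in> F" for x
  proof (rule ccontr)
    assume "\<not> x < m + s"
    then have "edge n m x"
      using near[OF m(1)] near[OF that] z s by (intro edge_bulk) auto
    then show False using ind[OF m(1) that] by (simp add: adj_def)
  qed
  have "v \<in> F" if v: "m \<le> v" "v < m + s" for v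
  proof (rule ccontr)
    assume "v \<notin> F"
    moreover have "v \<in> {1..n}" using v m(1) m(2)[OF z(1)] z(3) s sub by auto
    ultimately obtain u where u: "u \<in> F" "adj n u v" using max by blast
    then have "u + s \<le> v \<or> v + s \<le> u" using edge_imp_far by (auto simp: adj_def)
    then show False using v m(2)[OF u(1)] close[OF u(1)] by linarith
  qed
  then have "F = {m..<m + s}" using m(2) close by auto
  moreover have "2 * r + 1 \<le> m + s" "m + 2 * r \<le> n"
    using near(2)[OF m(1)] m(2)[OF z(1)] z by auto
  ultimately show ?thesis using that by blast
qed

lemma interval_max_indep:
  assumes "4 * r \<le> n" "2 * r + 1 \<le> m + s" "m + 2 * r \<le> n"
  shows "max_indep (adj n) {1..n} {m..<m + s}" "{m..<m + s} \<inter> {2 * r..n - 2 * r} \<noteq> {}"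
proof -
  note s = sparsity_bounds
  define z where "z = max m (2 * r)"
  have z: "2 * r \<le> z" "z + 2 * r \<le> n" "z \<in> {m..<m + s}"
    using assms s by (auto simp: z_def)
  then show "{m..<m + s} \<inter> {2 * r..n - 2 * r} \<noteq> {}" by auto
  have "\<not> adj n x y" if "x \<in> {m..<m + s}" "y \<in> {m..<m + s}" for x y
    using that edge_imp_far[of n x y] edge_imp_far[of n y x] by (auto simp: adj_def)
  moreover have "\<exists>u\<in>{m..<m + s}. adj n u v" if v: "v \<in> {1..n} - {m..<m + s}" for v
  proof (cases "adj n v z")
    case True
    then show ?thesis using z(3) by (auto simp: adj_def)
  next
    case False
    then have "v < z + s" "z < v + s" using adj_central_iff[OF z(1,2), of v] v by auto
    \<comment> \<open>So \<open>v\<close> is far enough from both ends of \<open>{1..n}\<close> for \<open>edge_bulk\<close> to join it to the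
      opposite end of the interval.\<close>
    then have "edge n v (m + s - 1) \<or> edge n m v"
      using v z assms s edge_bulk[of v "m + s - 1" n] edge_bulk[of m v n] by auto
    moreover have "m \<in> {m..<m + s}" "m + s - 1 \<in> {m..<m + s}" using s by auto
    ultimately show ?thesis unfolding adj_def by blast
  qed
  moreover have "{m..<m + s} \<subseteq> {1..n}" using assms s by auto
  ultimately show "max_indep (adj n) {1..n} {m..<m + s}" by (auto simp: max_indep_def)
qed

lemma card_facets_central:
  assumes "4 * r \<le> n"
  shows "card {F. max_indep (adj n) {1..n} F \<and> F \<inter> {2 * r..n - 2 * r} \<noteq> {}} = n - 4 * r + s"
proof -
  note s = sparsity_bounds
  have "{F. max_indep (adj n) {1..n} F \<and> F \<inter> {2 * r..n - 2 * r} \<noteq> {}}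
      = (\<lambda>m. {m..<m + s}) ` {2 * r + 1 - s..n - 2 * r}" (is "?L = ?R")
  proof (intro set_eqI iffI)
    fix F assume "F \<in> ?L"
    then obtain z where F: "max_indep (adj n) {1..n} F" "z \<in> F" and "z \<in> {2 * r..n - 2 * r}"
      by blast
    then have "2 * r \<le> z" "z + 2 * r \<le> n" using assms by auto
    with F obtain m where "2 * r + 1 \<le> m + s" "m + 2 * r \<le> n" "F = {m..<m + s}"
      by (rule max_indep_central_imp_interval)
    moreover from this have "m \<in> {2 * r + 1 - s..n - 2 * r}" by auto
    ultimately show "F \<in> ?R" by blast
  next
    fix F assume "F \<in> ?R"
    then obtain m where "F = {m..<m + s}" "2 * r + 1 \<le> m + s" "m + 2 * r \<le> n"
      using assms by auto
    then show "F \<in> ?L" using interval_max_indep[OF assms, of m] by simp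
  qed
  moreover have "inj_on (\<lambda>m. {m..<m + s}) {2 * r + 1 - s..n - 2 * r}"
    using s by (simp add: inj_on_def atLeastLessThan_eq_iff)
  ultimately have "card ?L = card {2 * r + 1 - s..n - 2 * r}" by (simp add: card_image)
  also have "\<dots> = n - 4 * r + s" using assms s by simp
  finally show ?thesis .
qed

section \<open>Facets without central vertices\<close>

text \<open>
  Suppose the extreme central vertices are blocked by members of \<open>F\<close>, but a central vertex \<open>v\<close>
  between them is not. All of \<open>F\<close> is then within \<open>s\<close> of \<open>v\<close>, so \<open>2r\<close> can only be blocked from
  the right end and \<open>n - 2r\<close> only from the left end; but two vertices at opposite ends are more
  than \<open>2s\<close> apart.
\<close>

lemma max_indep_off_central_iff:
  assumes n: "5 * r + 2 * s \<le> n"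
  shows "max_indep (adj n) {1..n} F \<and> F \<inter> {2 * r..n - 2 * r} = {} \<longleftrightarrow>
    max_indep (adj n) ({1..2 * r} \<union> {n - 2 * r..n}) F \<and> F \<inter> {2 * r, n - 2 * r} = {}"
    (is "?L \<longleftrightarrow> ?R")
proof
  note s = sparsity_bounds
  assume L: ?L
  then have F: "F \<subseteq> {1..n}" "F \<inter> {2 * r..n - 2 * r} = {}" by (auto simp: max_indep_def)
  have "x \<in> {1..2 * r} \<union> {n - 2 * r..n}" if "x \<in> F" for x
  proof -
    have "1 \<le> x" "x \<le> n" "\<not> (2 * r \<le> x \<and> x \<le> n - 2 * r)" using that F by auto
    then show ?thesis by auto
  qed
  then have "F \<subseteq> {1..2 * r} \<union> {n - 2 * r..n}" by blast
  moreover have "{1..2 * r} \<union> {n - 2 * r..n} \<subseteq> {1..n}" using n s by auto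
  ultimately have "max_indep (adj n) ({1..2 * r} \<union> {n - 2 * r..n}) F"
    using L unfolding max_indep_def by blast
  moreover have "{2 * r, n - 2 * r} \<subseteq> {2 * r..n - 2 * r}" using n by auto
  then have "F \<inter> {2 * r, n - 2 * r} = {}" using F(2) by blast
  ultimately show ?R by blast
next
  note s = sparsity_bounds
  assume R: ?R
  have ends: "{1..2 * r} \<union> {n - 2 * r..n} \<subseteq> {1..n}" using n s by auto
  have sub: "F \<subseteq> {1..2 * r} \<union> {n - 2 * r..n}" and off: "2 * r \<notin> F" "n - 2 * r \<notin> F"
    and max: "\<And>v. v \<in> {1..2 * r} \<union> {n - 2 * r..n} \<Longrightarrow> v \<notin> F \<Longrightarrow> \<exists>u\<in>F. adj n u v"
    using R unfolding max_indep_def by blast+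
  have side: "1 \<le> u \<and> u < 2 * r \<or> n - 2 * r < u \<and> u \<le> n" if "u \<in> F" for u
  proof -
    have "u \<noteq> 2 * r" "u \<noteq> n - 2 * r" using that off by metis+
    then show ?thesis using sub that by fastforce
  qed
  have "\<exists>u\<in>F. adj n u v" if v: "v \<in> {1..n}" "v \<notin> F" for v
  proof (cases "v \<in> {1..2 * r} \<union> {n - 2 * r..n}")
    case True
    then show ?thesis using max v by blast
  next
    case False
    then have central: "2 * r < v" "v < n - 2 * r" using v by auto
    show ?thesis
    proof (rule ccontr)
      assume "\<not> ?thesis"
      then have close: "u < v + s \<and> v < u + s" if "u \<in> F" for u
        using adj_central_iff[of v n u] central side[OF that] that n by force
      obtain u where u: "u \<in> F" "adj n u (2 * r)" using max[of "2 * r"] off s by force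
      obtain w where w: "w \<in> F" "adj n w (n - 2 * r)" using max[of "n - 2 * r"] off s by force
      have "u + s \<le> 2 * r \<or> 2 * r + s \<le> u"
        using u(2) edge_imp_far by (auto simp: adj_def)
      then have "n - 2 * r < u" using close[OF u(1)] central side[OF u(1)] by linarith
      moreover have "w + s \<le> n - 2 * r \<or> n - 2 * r + s \<le> w"
        using w(2) edge_imp_far by (auto simp: adj_def)
      then have "w < 2 * r" using close[OF w(1)] central side[OF w(1)] by linarith
      ultimately show False using close[OF u(1)] close[OF w(1)] n by linarith
    qed
  qed
  moreover have "F \<inter> {2 * r..n - 2 * r} = {}" using side by fastforce
  moreover have "F \<subseteq> {1..n}" using sub ends by blast
  ultimately show ?L using R unfolding max_indep_def by blast
qed

text \<open>
  Pulling the two ends of \<open>{1..N}\<close> apart changes, for a pair of end vertices, only gaps that are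
  at least \<open>r\<close> before and after; such gaps satisfy the inequality of every generator.
\<close>

lemma edge_of_stretch_iff:
  assumes "5 * r \<le> N" "N \<le> n"
    and "x \<in> {1..2 * r} \<union> {N - 2 * r..N}" "y \<in> {1..2 * r} \<union> {N - 2 * r..N}"
  defines "\<phi> \<equiv> \<lambda>x. if x \<le> 2 * r then x else x + (n - N)"
  shows "edge n (\<phi> x) (\<phi> y) \<longleftrightarrow> edge N x y"
proof -
  have "(i \<le> \<phi> x \<and> \<phi> x + j \<le> \<phi> y + i \<and> \<phi> y + r \<le> n + j) \<longleftrightarrow>
      (i \<le> x \<and> x + j \<le> y + i \<and> y + r \<le> N + j)" if "(i, j) \<in> E" for i j
  proof -
    have "1 \<le> i \<and> i < j \<and> j \<le> r" using edge_bounds[OF that] .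
    moreover have "x \<le> 2 * r \<or> N - 2 * r \<le> x" "y \<le> 2 * r \<or> N - 2 * r \<le> y"
      using assms(3,4) by auto
    ultimately show ?thesis
      using assms(1,2) unfolding \<phi>_def by (cases "x \<le> 2 * r"; cases "y \<le> 2 * r"; simp; linarith)
  qed
  then show ?thesis unfolding edge_of_def by blast
qed

lemma card_facets_off_central:
  assumes N: "5 * r + 2 * s \<le> N" and "N \<le> n"
  shows "card {F. max_indep (adj N) {1..N} F \<and> F \<inter> {2 * r..N - 2 * r} = {}} =
    card {F. max_indep (adj n) {1..n} F \<and> F \<inter> {2 * r..n - 2 * r} = {}}"
proof -
  note s = sparsity_bounds
  define \<phi> where "\<phi> = (\<lambda>x. if x \<le> 2 * r then x else x + (n - N))"
  define ends where "ends = (\<lambda>k. {1..2 * r} \<union> {k - 2 * r..k})"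
  have "bij_betw \<phi> (ends N) (ends n)"
  proof (rule bij_betw_byWitness[where f' = "\<lambda>x. if x \<le> 2 * r then x else x - (n - N)"])
    show "\<phi> ` ends N \<subseteq> ends n" using assms s by (auto simp: \<phi>_def ends_def)
    show "(\<lambda>x. if x \<le> 2 * r then x else x - (n - N)) ` ends n \<subseteq> ends N"
      using assms s by (auto simp: ends_def)
  qed (use assms s in \<open>auto simp: \<phi>_def ends_def\<close>)
  moreover have "adj n (\<phi> x) (\<phi> y) \<longleftrightarrow> adj N x y" if "x \<in> ends N" "y \<in> ends N" for x y
    using edge_of_stretch_iff[of N n x y] edge_of_stretch_iff[of N n y x] that assms
    by (simp add: adj_def \<phi>_def ends_def)
  moreover have "{2 * r, N - 2 * r} \<subseteq> ends N" using N s by (auto simp: ends_def)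
  ultimately have "card {F. max_indep (adj N) (ends N) F \<and> F \<inter> {2 * r, N - 2 * r} = {}} =
      card {F. max_indep (adj n) (ends n) F \<and> F \<inter> \<phi> ` {2 * r, N - 2 * r} = {}}"
    by (rule card_max_indep_iso)
  moreover have "\<phi> ` {2 * r, N - 2 * r} = {2 * r, n - 2 * r}"
    using assms s by (auto simp: \<phi>_def)
  moreover have n: "5 * r + 2 * s \<le> n" using assms by simp
  ultimately show ?thesis
    unfolding ends_def by (simp only: max_indep_off_central_iff[OF N] max_indep_off_central_iff[OF n])
qed

lemma card_max_indep_eq:
  assumes n: "5 * r + 2 * s \<le> n"
  shows "int (card {F. max_indep (adj n) {1..n} F}) =
    int n + (int s - 4 * int r + int (card {F. max_indep (adj (5 * r + 2 * s)) {1..5 * r + 2 * s} F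
      \<and> F \<inter> {2 * r..5 * r + 2 * s - 2 * r} = {}}))"
proof -
  let ?M = "{F. max_indep (adj n) {1..n} F}"
  let ?M1 = "{F. max_indep (adj n) {1..n} F \<and> F \<inter> {2 * r..n - 2 * r} \<noteq> {}}"
  let ?M2 = "{F. max_indep (adj n) {1..n} F \<and> F \<inter> {2 * r..n - 2 * r} = {}}"
  have "finite ?M" by (rule finite_subset[of _ "Pow {1..n}"]) (auto simp: max_indep_def)
  then have "finite ?M1" "finite ?M2" by (auto elim: rev_finite_subset)
  moreover have "?M1 \<inter> ?M2 = {}" by blast
  ultimately have "card (?M1 \<union> ?M2) = card ?M1 + card ?M2" by (rule card_Un_disjoint)
  moreover have "?M1 \<union> ?M2 = ?M" by blast
  ultimately have "card ?M = card ?M1 + card ?M2" by (simp only:)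
  moreover have "card ?M1 = n - 4 * r + s" using card_facets_central n by simp
  moreover note card_facets_off_central[OF order_refl n, symmetric]
  moreover have "int (n - 4 * r + s) = int n + (int s - 4 * int r)" using n by simp
  ultimately show ?thesis by (simp only: of_nat_add add.assoc)
qed

end

section \<open>The number of facets\<close>

lemma generating_edges_of_chain:
  assumes chain: "inc_invariant_chain G"
    and r: "stability_index G = r" and s: "sparsity_index G = s"
    and "\<exists>i \<in> {1..r}. \<exists>j \<in> {1..r}. (1, i) \<in> edges (G r) \<and> (j, r) \<in> edges (G r)"
  shows "generating_edges (edges (G r)) r s"
proof -
  have r1: "1 \<le> r" using stability_index_stable(1)[OF chain] r by simp
  note bounds = chain_edgeD[OF chain r1]
  define D where "D = {j - i | i j. (i, j) \<in> edges (G r)}"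
  have "D \<subseteq> {..r}" using bounds unfolding D_def by fastforce
  then have fin: "finite D" using finite_subset by blast
  have "D \<noteq> {}" using assms(4) by (auto simp: D_def)
  moreover have sD: "s = Min D" using s r by (simp add: sparsity_index_def D_def)
  ultimately have "s \<in> D" using fin by simp
  then obtain i j where "(i, j) \<in> edges (G r)" "s = j - i" by (auto simp: D_def)
  then have shortest: "(i, i + s) \<in> edges (G r)" using bounds[of i j] by simp
  have sparse: "i + s \<le> j" if "(i, j) \<in> edges (G r)" for i j
  proof -
    have "s \<le> j - i" unfolding sD using fin that by (intro Min_le) (auto simp: D_def)
    then show ?thesis using bounds[OF that] by simp
  qed
  show ?thesis
    using bounds shortest sparse assms(4) by unfold_locales blast+
qed

theorem theorem4p7:
  fixes G :: "nat \<Rightarrow> graph" and r s :: nat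
  assumes "inc_invariant_chain G"
    and "stability_index G = r"
    and "sparsity_index G = s"
    and "verts (G r) = {1..r}"
    and "\<exists>i \<in> {1..r}. \<exists>j \<in> {1..r}. (1, i) \<in> edges (G r) \<and> (j, r) \<in> edges (G r)"
  shows "\<exists>C :: int. \<forall>n \<ge> 5 * r + 2 * s.
           int (card (facets (independence_complex (G n)))) = int n + C"
proof -
  interpret generating_edges "edges (G r)" r s
    using generating_edges_of_chain assms(1-3,5) .
  have "facets (independence_complex (G n)) = {F. max_indep (adj n) {1..n} F}"
    if "5 * r + 2 * s \<le> n" for n
  proof -
    have "r \<le> n" "1 \<le> n" using that sparsity_bounds by auto
    then show ?thesis
      using facets_independence_complex[of "G n"] chain_edgeD(2)[OF assms(1)]
        edges_beyond_stability[OF assms(1,2)] verts_beyond_stability[OF assms(1,2) _ assms(4)]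
      by (auto simp: adj_def[abs_def])
  qed
  then show ?thesis using card_max_indep_eq by auto
qed

end
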